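(* If $(\mathcal{L},\mathcal{H},(\cdot,\cdot))$ is an extended affine Lie superalgebra, then the triple $(\mathcal{L}_{\bar 0},\mathcal{H},(\cdot,\cdot)|_{\mathcal{L}_{\bar 0}\times\mathcal{L}_{\bar 0}})$ is an invariant affine reflection algebra.
   Context: All vector spaces are over a field $\mathbb{F}$ of characteristic zero. A super-toral triple $(\mathcal{L},\mathcal{H},(\cdot,\cdot))$ consists of a nonzero Lie superalgebra $\mathcal{L}=\mathcal{L}_{\bar 0}\oplus\mathcal{L}_{\bar 1}$, a nontrivial (nonzero) subalgebra $\mathcal{H}$ of $\mathcal{L}_{\bar 0}$ and a nondegenerate invariant even supersymmetric bilinear form $(\cdot,\cdot)$ on $\mathcal{L}$ such that: $\mathcal{L}$ has a weight space decomposition $\mathcal{L}=\bigoplus_{\alpha\in\mathcal{H}^*}\mathcal{L}^\alpha$ with respect to $\mathcal{H}$ via the adjoint representation, where $\mathcal{L}^\alpha=\{x\in\mathcal{L}\mid [h,x]=\alpha(h)x\ \forall h\in\mathcal{H}\}$; and the restriction of the form to $\mathcal{H}$ is nondegenerate. Then $\mathcal{H}$ is abelian and, for $i\in\{0,1\}$, $\mathcal{L}_{\bar i}=\bigoplus_\alpha\mathcal{L}_{\bar i}^\alpha$ with $\mathcal{L}_{\bar i}^\alpha:=\mathcal{L}_{\bar i}\cap\mathcal{L}^\alpha$. Put $R:=\{\alpha\in\mathcal{H}^*\mid\mathcal{L}^\alpha\neq\{0\}\}$ (the root system) and $R_i:=\{\alpha\in\mathcal{H}^*\mid\mathcal{L}_{\bar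 i}^\alpha\neq\{0\}\}$ for $i=0,1$, so $R=R_0\cup R_1$. Let $\mathfrak{p}:\mathcal{H}\to\mathcal{H}^*$, $h\mapsto(h,\cdot)$, which is injective, and let $\mathcal{H}^{\mathfrak{p}}$ be its image. For $\alpha\in\mathcal{H}^{\mathfrak{p}}$ let $t_\alpha\in\mathcal{H}$ be the unique element with $\alpha=(t_\alpha,\cdot)$ on $\mathcal{H}$, and set $(\alpha,\beta):=(t_\alpha,t_\beta)$ for $\alpha,\beta\in\mathcal{H}^{\mathfrak{p}}$. A super-toral triple is an extended affine Lie superalgebra if (1) for $i\in\{0,1\}$ and $\alpha\in R_i\setminus\{0\}$ there are $x_\alpha\in\mathcal{L}_{\bar i}^\alpha$ and $x_{-\alpha}\in\mathcal{L}_{\bar i}^{-\alpha}$ with $0\neq[x_\alpha,x_{-\alpha}]\in\mathcal{H}$ (this implies $R\subseteq\mathcal{H}^{\mathfrak{p}}$, so that $(\alpha,\beta)$ is defined for roots), and (2) for $\alpha\in R$ with $(\alpha,\alpha)\neq0$ and $x\in\mathcal{L}^\alpha$, the map $\mathrm{ad}_x:\mathcal{L}\to\mathcal{L}$, $y\mapsto[x,y]$, is locally nilpotent. An extended affine Lie superalgebra $(\mathcal{L},\mathcal{H},(\cdot,\cdot))$ is called an invariant affine reflection algebra if $\mathcal{L}_{\bar 1}=\{0\}$. *)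

theory Defs
  imports Complex_Main "HOL-Library.Z2"
begin

text \<open>
  Vector spaces are subspaces of an ambient vector space over a field of characteristic zero, so
  that the even part of a Lie superalgebra is an object of the same kind as the whole.  Brackets and
  forms are functions on the ambient type, but every notion below depends only on their values on
  the carrier; restricting a bracket or a form to a subspace just means changing the carrier.
\<close>

definition linear_on ::
  "('k \<Rightarrow> 'v::ab_group_add \<Rightarrow> 'v) \<Rightarrow> ('k \<Rightarrow> 'w::ab_group_add \<Rightarrow> 'w) \<Rightarrow> 'v set \<Rightarrow> ('v \<Rightarrow> 'w) \<Rightarrow> bool"
  where "linear_on s1 s2 V f \<longleftrightarrow>
    (\<forall>x\<in>V. \<forall>y\<in>V. f (x + y) = f x + f y) \<and> (\<forall>c. \<forall>x\<in>V. f (s1 c x) = s2 c (f x))"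

definition bilinear_on ::
  "('k \<Rightarrow> 'v::ab_group_add \<Rightarrow> 'v) \<Rightarrow> ('k \<Rightarrow> 'w::ab_group_add \<Rightarrow> 'w) \<Rightarrow> 'v set
    \<Rightarrow> ('v \<Rightarrow> 'v \<Rightarrow> 'w) \<Rightarrow> bool"
  where "bilinear_on s1 s2 V f \<longleftrightarrow>
    (\<forall>x\<in>V. linear_on s1 s2 V (f x)) \<and> (\<forall>y\<in>V. linear_on s1 s2 V (\<lambda>x. f x y))"

definition nondegenerate_on :: "'v::zero set \<Rightarrow> ('v \<Rightarrow> 'v \<Rightarrow> 'k::zero) \<Rightarrow> bool"
  where "nondegenerate_on V form \<longleftrightarrow>
    (\<forall>x\<in>V. (\<forall>y\<in>V. form x y = 0) \<longrightarrow> x = 0) \<and> (\<forall>y\<in>V. (\<forall>x\<in>V. form x y = 0) \<longrightarrow> y = 0)"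

definition koszul_sign :: "bit \<Rightarrow> bit \<Rightarrow> 'k::ring_1"
  where "koszul_sign i j = (if i = 1 \<and> j = 1 then - 1 else 1)"

context vector_space
begin

definition is_direct_sum :: "'b set \<Rightarrow> 'i set \<Rightarrow> ('i \<Rightarrow> 'b set) \<Rightarrow> bool"
  where "is_direct_sum V I W \<longleftrightarrow>
    subspace V \<and> (\<forall>i\<in>I. subspace (W i) \<and> W i \<subseteq> V) \<and>
    (\<forall>x\<in>V. \<exists>!f. (\<forall>i\<in>I. f i \<in> W i) \<and> (\<forall>i. i \<notin> I \<longrightarrow> f i = 0) \<and>
      finite {i. f i \<noteq> 0} \<and> x = (\<Sum>i | f i \<noteq> 0. f i))"

text \<open>
  Functionals on \<open>H\<close> are extended by zero outside \<open>H\<close>, which makes them unique as functions.  The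
  zero functional is then \<open>\<lambda>_. 0\<close>, and the negative of \<open>\<alpha>\<close> is \<open>\<lambda>h. - \<alpha> h\<close>.
\<close>

definition dual :: "'b set \<Rightarrow> ('b \<Rightarrow> 'a) set"
  where "dual H = {\<alpha>. linear_on scale (*) H \<alpha> \<and> (\<forall>x. x \<notin> H \<longrightarrow> \<alpha> x = 0)}"

end

text \<open>\<open>g i\<close> is the homogeneous component of \<open>L\<close> of degree \<open>i\<close>.\<close>

locale lie_superalgebra = vector_space scale
  for scale :: "'k::field_char_0 \<Rightarrow> 'v::ab_group_add \<Rightarrow> 'v" (infixr \<open>*s\<close> 75) +
  fixes L :: "'v set" and g :: "bit \<Rightarrow> 'v set" and br :: "'v \<Rightarrow> 'v \<Rightarrow> 'v"
  assumes grading: "is_direct_sum L UNIV g"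
    and bracket_bilinear: "bilinear_on scale scale L br"
    and bracket_graded: "\<lbrakk>x \<in> g i; y \<in> g j\<rbrakk> \<Longrightarrow> br x y \<in> g (i + j)"
    and bracket_skew: "\<lbrakk>x \<in> g i; y \<in> g j\<rbrakk> \<Longrightarrow> br x y = - (koszul_sign i j *s br y x)"
    and bracket_jacobi: "\<lbrakk>x \<in> g i; y \<in> g j; z \<in> g k\<rbrakk> \<Longrightarrow>
      br x (br y z) = br (br x y) z + koszul_sign i j *s br y (br x z)"

locale lie_superalgebra_with_subalgebra = lie_superalgebra scale L g br
  for scale :: "'k::field_char_0 \<Rightarrow> 'v::ab_group_add \<Rightarrow> 'v" (infixr \<open>*s\<close> 75)
    and L g br +
  fixes H :: "'v set"
  assumes H_subspace: "subspace H"
    and H_even: "H \<subseteq> g 0"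
    and H_closed: "\<lbrakk>h \<in> H; h' \<in> H\<rbrakk> \<Longrightarrow> br h h' \<in> H"
begin

definition weight_space :: "('v \<Rightarrow> 'k) \<Rightarrow> 'v set"
  where "weight_space \<alpha> = {x \<in> L. \<forall>h\<in>H. br h x = \<alpha> h *s x}"

definition homogeneous_weight_space :: "bit \<Rightarrow> ('v \<Rightarrow> 'k) \<Rightarrow> 'v set"
  where "homogeneous_weight_space i \<alpha> = g i \<inter> weight_space \<alpha>"

definition roots :: "('v \<Rightarrow> 'k) set"
  where "roots = {\<alpha> \<in> dual H. weight_space \<alpha> \<noteq> {0}}"

definition homogeneous_roots :: "bit \<Rightarrow> ('v \<Rightarrow> 'k) set"
  where "homogeneous_roots i = {\<alpha> \<in> dual H. homogeneous_weight_space i \<alpha> \<noteq> {0}}"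

lemma roots_eq_Un: "roots = homogeneous_roots 0 \<union> homogeneous_roots 1"
proof
  have sub0: "0 \<in> g i" and gL: "g i \<subseteq> L" and gsub: "subspace (g i)" for i
    using grading subspace_0 unfolding is_direct_sum_def by auto
  have HL: "H \<subseteq> L" using H_even gL by blast
  have lin: "br h (a + b) = br h a + br h b" if "h \<in> H" "a \<in> L" "b \<in> L" for h a b
    using that HL bracket_bilinear unfolding bilinear_on_def linear_on_def by blast
  have zero: "br h 0 = 0" if "h \<in> H" for h
    using lin[OF that, of 0 0] sub0 gL by auto
  show "homogeneous_roots 0 \<union> homogeneous_roots 1 \<subseteq> roots"
  proof
    fix \<alpha> assume "\<alpha> \<in> homogeneous_roots 0 \<union> homogeneous_roots 1"
    then obtain i where a: "\<alpha> \<in> dual H" "homogeneous_weight_space i \<alpha> \<noteq> {0}"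
      unfolding homogeneous_roots_def by blast
    have "0 \<in> homogeneous_weight_space i \<alpha>"
      using sub0 gL zero unfolding homogeneous_weight_space_def weight_space_def by auto
    then have "\<exists>x. x \<in> homogeneous_weight_space i \<alpha> \<and> x \<noteq> 0" using a(2) by blast
    then have "weight_space \<alpha> \<noteq> {0}" unfolding homogeneous_weight_space_def by blast
    then show "\<alpha> \<in> roots" using a(1) unfolding roots_def by blast
  qed
  show "roots \<subseteq> homogeneous_roots 0 \<union> homogeneous_roots 1"
  proof
    fix \<alpha> assume "\<alpha> \<in> roots"
    then have d: "\<alpha> \<in> dual H" and "weight_space \<alpha> \<noteq> {0}" unfolding roots_def by auto
    moreover have "0 \<in> weight_space \<alpha>"
      using sub0 gL zero unfolding weight_space_def by auto
    ultimately obtain x where x: "x \<in> weight_space \<alpha>" "x \<noteq> 0" by blast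
    have xL: "x \<in> L" and xw: "\<And>h. h \<in> H \<Longrightarrow> br h x = \<alpha> h *s x"
      using x unfolding weight_space_def by auto
    have bits: "(UNIV :: bit set) = {0, 1}" by (auto intro: bit.exhaust)
    have fin: "finite A" for A :: "bit set"
      by (rule finite_subset[OF subset_UNIV]) (simp add: bits)
    have sum01: "(\<Sum>i | f i \<noteq> 0. f i) = f 0 + f 1" for f :: "bit \<Rightarrow> 'v"
    proof -
      have "(\<Sum>i | f i \<noteq> 0. f i) = (\<Sum>i\<in>{0, 1}. f i)"
        unfolding bits[symmetric] by (rule sum.mono_neutral_left) (use fin in auto)
      then show ?thesis by simp
    qed
    have ex1: "\<exists>!f. (\<forall>i. f i \<in> g i) \<and> v = f 0 + f 1" if "v \<in> L" for v
      using grading that fin unfolding is_direct_sum_def sum01 by simp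
    have ex1_uniq: "p = q" if "v \<in> L" "\<forall>i. p i \<in> g i" "v = p 0 + p 1"
      "\<forall>i. q i \<in> g i" "v = q 0 + q 1" for v p q
      using ex1[OF that(1)] that(2-) by (elim ex1E) metis
    obtain f where f: "\<And>i. f i \<in> g i" "x = f 0 + f 1" using ex1[OF xL] by blast
    have fw: "f i \<in> weight_space \<alpha>" for i
    proof -
      have "br h (f j) = \<alpha> h *s f j" if h: "h \<in> H" for h j
      proof -
        have "(\<forall>i. br h (f i) \<in> g i)"
          using bracket_graded[of h 0 "f _"] f(1) H_even h by (metis add_0 subsetD)
        moreover have "br h x = br h (f 0) + br h (f 1)"
          using lin[OF h] f gL by (metis subsetD)
        moreover have "\<forall>i. \<alpha> h *s f i \<in> g i" using f(1) gsub subspace_scale by blast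
        moreover have "br h x = \<alpha> h *s f 0 + \<alpha> h *s f 1"
          using xw[OF h] f(2) scale_right_distrib by simp
        moreover have "br h x \<in> L"
          using xw[OF h] xL grading subspace_scale unfolding is_direct_sum_def by auto
        ultimately have "(\<lambda>i. br h (f i)) = (\<lambda>i. \<alpha> h *s f i)"
          using ex1_uniq[of "br h x" "\<lambda>i. br h (f i)" "\<lambda>i. \<alpha> h *s f i"] by simp
        then show ?thesis by (rule fun_cong)
      qed
      then show ?thesis using f(1) gL unfolding weight_space_def by blast
    qed
    have "f 0 \<noteq> 0 \<or> f 1 \<noteq> 0" using f(2) x(2) by auto
    then show "\<alpha> \<in> homogeneous_roots 0 \<union> homogeneous_roots 1"
      using d f(1) fw unfolding homogeneous_roots_def homogeneous_weight_space_def by blast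
  qed
qed

end

locale super_toral_triple = lie_superalgebra_with_subalgebra scale L g br H
  for scale :: "'k::field_char_0 \<Rightarrow> 'v::ab_group_add \<Rightarrow> 'v" (infixr \<open>*s\<close> 75)
    and L g br H +
  fixes form :: "'v \<Rightarrow> 'v \<Rightarrow> 'k"
  assumes L_nonzero: "L \<noteq> {0}"
    and H_nonzero: "H \<noteq> {0}"
    and form_bilinear: "bilinear_on scale (*) L form"
    and form_nondegenerate: "nondegenerate_on L form"
    and form_invariant: "\<lbrakk>x \<in> L; y \<in> L; z \<in> L\<rbrakk> \<Longrightarrow> form (br x y) z = form x (br y z)"
    and form_even: "\<lbrakk>x \<in> g i; y \<in> g j; i \<noteq> j\<rbrakk> \<Longrightarrow> form x y = 0"
    and form_supersymmetric: "\<lbrakk>x \<in> g i; y \<in> g j\<rbrakk> \<Longrightarrow> form x y = koszul_sign i j * form y x"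
    and weight_decomposition: "is_direct_sum L (dual H) weight_space"
    and form_nondegenerate_H: "nondegenerate_on H form"
begin

definition H_flat :: "('v \<Rightarrow> 'k) set"
  where "H_flat = {\<alpha> \<in> dual H. \<exists>t\<in>H. \<forall>h\<in>H. \<alpha> h = form t h}"

text \<open>\<open>t_elem \<alpha>\<close> and \<open>dual_form \<alpha> \<beta>\<close> are meaningful only for \<open>\<alpha>\<close> and \<open>\<beta>\<close> in \<^const>\<open>H_flat\<close>.\<close>

definition t_elem :: "('v \<Rightarrow> 'k) \<Rightarrow> 'v"
  where "t_elem \<alpha> = (THE t. t \<in> H \<and> (\<forall>h\<in>H. \<alpha> h = form t h))"

definition dual_form :: "('v \<Rightarrow> 'k) \<Rightarrow> ('v \<Rightarrow> 'k) \<Rightarrow> 'k"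
  where "dual_form \<alpha> \<beta> = form (t_elem \<alpha>) (t_elem \<beta>)"

lemma t_elem_unique:
  assumes "t \<in> H" "\<And>h. h \<in> H \<Longrightarrow> \<alpha> h = form t h"
  shows "t_elem \<alpha> = t"
  unfolding t_elem_def
proof (rule the_equality)
  show "t \<in> H \<and> (\<forall>h\<in>H. \<alpha> h = form t h)" using assms by blast
next
  fix u assume u: "u \<in> H \<and> (\<forall>h\<in>H. \<alpha> h = form u h)"
  have sub: "H \<subseteq> L"
    using H_even grading unfolding is_direct_sum_def by blast
  have "u - t \<in> H" using u assms(1) H_subspace subspace_diff by blast
  moreover have "form (u - t) h = 0" if h: "h \<in> H" for h
  proof -
    have "form (u - t + t) h = form (u - t) h + form t h"
      using form_bilinear sub h assms(1) \<open>u - t \<in> H\<close>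
      unfolding bilinear_on_def linear_on_def by blast
    then show ?thesis using u assms(2) h by simp
  qed
  ultimately have "u - t = 0" using form_nondegenerate_H unfolding nondegenerate_on_def by blast
  then show "u = t" by simp
qed

end

text \<open>
  The first axiom forces all roots to lie in \<open>H_flat\<close> (lemma \<open>roots_subset_H_flat\<close>), so that
  \<open>dual_form\<close> is meaningful in the second.
\<close>

locale extended_affine_lie_superalgebra = super_toral_triple scale L g br H form
  for scale :: "'k::field_char_0 \<Rightarrow> 'v::ab_group_add \<Rightarrow> 'v" (infixr \<open>*s\<close> 75)
    and L g br H form +
  assumes root_pairing: "\<lbrakk>\<alpha> \<in> homogeneous_roots i; \<alpha> \<noteq> (\<lambda>_. 0)\<rbrakk> \<Longrightarrow>
      \<exists>x\<in>homogeneous_weight_space i \<alpha>. \<exists>y\<in>homogeneous_weight_space i (\<lambda>h. - \<alpha> h).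
        br x y \<noteq> 0 \<and> br x y \<in> H"
    and ad_locally_nilpotent: "\<lbrakk>\<alpha> \<in> roots; dual_form \<alpha> \<alpha> \<noteq> 0; x \<in> weight_space \<alpha>; y \<in> L\<rbrakk> \<Longrightarrow>
      \<exists>n. (br x ^^ n) y = 0"
begin

lemma homogeneous_root_in_H_flat:
  assumes "\<alpha> \<in> homogeneous_roots i"
  shows "\<alpha> \<in> H_flat"
proof (cases "\<alpha> = (\<lambda>_. 0)")
  case True
  have "0 \<in> H" using H_subspace subspace_0 by blast
  then have "0 \<in> L" using H_even grading unfolding is_direct_sum_def by blast
  have "form 0 h = 0" if "h \<in> H" for h
  proof -
    have "h \<in> L" using that H_even grading unfolding is_direct_sum_def by blast
    then have "form (0 + 0) h = form 0 h + form 0 h"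
      using form_bilinear \<open>0 \<in> L\<close> unfolding bilinear_on_def linear_on_def by blast
    then show ?thesis by simp
  qed
  then show ?thesis
    using assms True \<open>0 \<in> H\<close> unfolding H_flat_def homogeneous_roots_def by fastforce
next
  case False
  then obtain x y where x: "x \<in> homogeneous_weight_space i \<alpha>"
    and y: "y \<in> homogeneous_weight_space i (\<lambda>h. - \<alpha> h)"
    and b: "br x y \<noteq> 0" "br x y \<in> H"
    using root_pairing[OF assms] by blast
  have HL: "H \<subseteq> L" using H_even grading unfolding is_direct_sum_def by blast
  have xL: "x \<in> L" and yL: "y \<in> L" and xw: "\<And>h. h \<in> H \<Longrightarrow> br h x = \<alpha> h *s x"
    using x y unfolding homogeneous_weight_space_def weight_space_def by auto
  have hb: "form h (br x y) = \<alpha> h * form x y" if h: "h \<in> H" for h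
  proof -
    have "form h (br x y) = form (br h x) y" using form_invariant[of h x y] h HL xL yL by auto
    also have "\<dots> = \<alpha> h * form x y"
      using xw[OF h] form_bilinear xL yL unfolding bilinear_on_def linear_on_def by auto
    finally show ?thesis .
  qed
  have nz: "form x y \<noteq> 0"
  proof
    assume "form x y = 0"
    then have "\<forall>h\<in>H. form h (br x y) = 0" using hb by simp
    then show False using b form_nondegenerate_H unfolding nondegenerate_on_def by blast
  qed
  define t where "t = inverse (form x y) *s br x y"
  have "t \<in> H" using b H_subspace subspace_scale unfolding t_def by blast
  moreover have "\<alpha> h = form t h" if h: "h \<in> H" for h
  proof -
    have "form t h = inverse (form x y) * form (br x y) h"
      using form_bilinear b h HL unfolding t_def bilinear_on_def linear_on_def by blast
    also have "form (br x y) h = form h (br x y)"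
      using form_supersymmetric[of "br x y" 0 h 0] b h H_even by (auto simp: koszul_sign_def)
    finally show ?thesis using hb[OF h] nz by simp
  qed
  ultimately show ?thesis using assms unfolding H_flat_def homogeneous_roots_def by blast
qed

corollary roots_subset_H_flat: "roots \<subseteq> H_flat"
  using roots_eq_Un homogeneous_root_in_H_flat by blast

end

locale invariant_affine_reflection_algebra = extended_affine_lie_superalgebra scale L g br H form
  for scale :: "'k::field_char_0 \<Rightarrow> 'v::ab_group_add \<Rightarrow> 'v" (infixr \<open>*s\<close> 75)
    and L g br H form +
  assumes odd_part_zero: "g 1 = {0}"

end

theory Submission
  imports Defs
begin

text \<open>
  The projection of \<open>L\<close> onto its even part is linear and commutes with the adjoint action of
  \<open>H \<subseteq> g 0\<close>, so it preserves weight spaces and the weight space decomposition of \<open>L\<close> restricts to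
  \<open>g 0\<close>.  The form stays nondegenerate on \<open>g 0\<close> because it is even.  The two axioms of an extended
  affine Lie superalgebra are inherited, since every even root is a root of \<open>L\<close> with the same \<open>t_elem\<close>.
\<close>

section \<open>Linear and bilinear maps on a carrier\<close>

lemma linear_on_add:
  "\<lbrakk>linear_on s1 s2 V f; x \<in> V; y \<in> V\<rbrakk> \<Longrightarrow> f (x + y) = f x + f y"
  unfolding linear_on_def by blast

lemma bilinear_on_mono:
  "\<lbrakk>bilinear_on s1 s2 V f; U \<subseteq> V\<rbrakk> \<Longrightarrow> bilinear_on s1 s2 U f"
  unfolding bilinear_on_def linear_on_def by blast

lemma bilinear_on_zero:
  fixes V :: "'v::ab_group_add set" and f :: "'v \<Rightarrow> 'v \<Rightarrow> 'w::ab_group_add"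
  assumes "bilinear_on s1 s2 V f" "0 \<in> V" "x \<in> V"
  shows "f x 0 = 0" "f 0 x = 0"
proof -
  have "linear_on s1 s2 V (f x)" "linear_on s1 s2 V (\<lambda>y. f y x)"
    using assms unfolding bilinear_on_def by blast+
  \<comment> \<open>Additivity at \<open>0 + 0\<close> gives \<open>f x 0 = f x 0 + f x 0\<close>,
    and likewise in the other argument.\<close>
  from this[THEN linear_on_add, OF assms(2) assms(2)] show "f x 0 = 0" "f 0 x = 0" by simp_all
qed

section \<open>Direct sums: two summands, and restriction along a projection\<close>

context vector_space
begin

text \<open>As \<open>bit\<close> is finite, the support condition is vacuous and the sum collapses
  to \<open>f 0 + f 1\<close>. Uniqueness of \<open>f\<close> then amounts to trivial intersection
  of the two summands.\<close>

lemma is_direct_sum_bit_iff: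
  fixes W :: "bit \<Rightarrow> 'b set"
  shows "is_direct_sum V UNIV W \<longleftrightarrow> subspace V \<and> (\<forall>i. subspace (W i) \<and> W i \<subseteq> V) \<and>
    W 0 \<inter> W 1 \<subseteq> {0} \<and> (\<forall>x\<in>V. \<exists>a\<in>W 0. \<exists>b\<in>W 1. x = a + b)"
    (is "_ \<longleftrightarrow> ?sub \<and> ?subs \<and> ?disj \<and> ?ex")
proof -
  have bits: "(UNIV :: bit set) = {0, 1}" by (auto intro: bit.exhaust)
  have fin: "finite A" for A :: "bit set"
    by (rule finite_subset[OF subset_UNIV]) (simp add: bits)
  have all: "(\<forall>i. P i) \<longleftrightarrow> P 0 \<and> P 1" for P :: "bit \<Rightarrow> bool"
    by (metis bit.exhaust)
  have sum01: "(\<Sum>i | f i \<noteq> 0. f i) = f 0 + f 1" for f :: "bit \<Rightarrow> 'b"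
  proof -
    have "(\<Sum>i | f i \<noteq> 0. f i) = (\<Sum>i\<in>{0, 1}. f i)"
      unfolding bits[symmetric] by (rule sum.mono_neutral_left) (use fin in auto)
    then show ?thesis by simp
  qed
  have eq: "is_direct_sum V UNIV W \<longleftrightarrow> ?sub \<and> ?subs \<and>
      (\<forall>x\<in>V. \<exists>!f. (\<forall>i. f i \<in> W i) \<and> x = f 0 + f 1)"
    using fin unfolding is_direct_sum_def sum01 by simp
  show ?thesis
  proof
    assume "is_direct_sum V UNIV W"
    note ds = this[unfolded eq]
    have V: ?sub and W: ?subs using ds by blast+
    have ex1: "\<exists>!f. (\<forall>i. f i \<in> W i) \<and> x = f 0 + f 1" if "x \<in> V" for x
      using ds that by (elim conjE bspec)
    have ?disj
    proof
      fix x assume x: "x \<in> W 0 \<inter> W 1"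
      \<comment> \<open>For \<open>x\<close> in both summands, \<open>x + (- x)\<close> is a
        decomposition of \<open>0\<close>; uniqueness identifies it with the zero
        decomposition.\<close>
      define f where "f = (\<lambda>i::bit. if i = 0 then x else - x)"
      note ex1[OF subspace_0[OF V]]
      moreover have "(\<forall>i. f i \<in> W i) \<and> 0 = f 0 + f 1"
        using x W subspace_neg by (auto simp: all f_def)
      moreover have "(\<forall>i. (\<lambda>_. 0) i \<in> W i) \<and> 0 = (\<lambda>_::bit. 0 :: 'b) 0 + (\<lambda>_. 0) (1::bit)"
        using W subspace_0 by simp
      ultimately have "f = (\<lambda>_. 0)" unfolding ex1_iff_ex_Uniq by (elim conjE Uniq_D) simp_all
      from fun_cong[OF this, of 0] show "x \<in> {0}" by (simp add: f_def)
    qed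
    moreover have ?ex using ex1[THEN ex1_implies_ex] by blast
    ultimately show "?sub \<and> ?subs \<and> ?disj \<and> ?ex" using V W by blast
  next
    assume *: "?sub \<and> ?subs \<and> ?disj \<and> ?ex"
    have "\<exists>!f. (\<forall>i. f i \<in> W i) \<and> x = f 0 + f 1" if "x \<in> V" for x
    proof -
      obtain a b where ab: "a \<in> W 0" "b \<in> W 1" "x = a + b" using * \<open>x \<in> V\<close> by blast
      show ?thesis
      proof (rule ex1I)
        show "(\<forall>i. (if i = 0 then a else b) \<in> W i)
            \<and> x = (if (0::bit) = 0 then a else b) + (if (1::bit) = 0 then a else b)"
          using ab by (simp add: all)
      next
        fix f assume f: "(\<forall>i. f i \<in> W i) \<and> x = f 0 + f 1"
        \<comment> \<open>Two decompositions of \<open>x\<close> differ by an element lying in both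
          \<open>W 0\<close> and \<open>W 1\<close>.\<close>
        then have e: "f 0 - a = b - f 1" using ab(3) by (simp add: algebra_simps)
        moreover have "f 0 - a \<in> W 0" "b - f 1 \<in> W 1" using f ab * subspace_diff by blast+
        ultimately have "f 0 - a = 0" using * by auto
        then have "f 0 = a" "f 1 = b" using e by simp_all
        then show "f = (\<lambda>i. if i = 0 then a else b)"
          unfolding fun_eq_iff by (simp add: all)
      qed
    qed
    with * show "is_direct_sum V UNIV W" unfolding eq by (elim conjE, intro conjI ballI)
  qed
qed

text \<open>Applying \<open>p\<close> to the components of \<open>x \<in> U\<close> yields
  components of \<open>p x = x\<close> that lie in \<open>U\<close> and in the same
  \<open>W i\<close>. It will be used with \<open>even_part\<close> as \<open>p\<close> and the
  weight spaces as \<open>W\<close>.\<close>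

lemma is_direct_sum_projection:
  assumes ds: "is_direct_sum V I W" and U: "subspace U" "U \<subseteq> V"
    and p_add: "\<And>x y. \<lbrakk>x \<in> V; y \<in> V\<rbrakk> \<Longrightarrow> p (x + y) = p x + p y"
    and p_in: "\<And>x. x \<in> V \<Longrightarrow> p x \<in> U"
    and p_id: "\<And>x. x \<in> U \<Longrightarrow> p x = x"
    and p_W: "\<And>i x. \<lbrakk>i \<in> I; x \<in> W i\<rbrakk> \<Longrightarrow> p x \<in> W i"
  shows "is_direct_sum U I (\<lambda>i. U \<inter> W i)"
proof -
  have V: "subspace V" and W: "\<And>i. i \<in> I \<Longrightarrow> subspace (W i) \<and> W i \<subseteq> V"
    and ex1: "\<And>x. x \<in> V \<Longrightarrow> \<exists>!f. (\<forall>i\<in>I. f i \<in> W i) \<and> (\<forall>i. i \<notin> I \<longrightarrow> f i = 0) \<and>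
      finite {i. f i \<noteq> 0} \<and> x = (\<Sum>i | f i \<noteq> 0. f i)"
    using ds unfolding is_direct_sum_def by blast+
  have p0: "p 0 = 0" using p_id U(1) subspace_0 by blast
  have p_sum: "p (sum f A) = (\<Sum>i\<in>A. p (f i))" if "finite A" "\<forall>i\<in>A. f i \<in> V" for f :: "'c \<Rightarrow> 'b" and A
    using that
  proof (induction A)
    case (insert a A)
    then have "sum f A \<in> V" by (intro subspace_sum[OF V]) blast
    then show ?case using insert p_add by simp
  qed (simp add: p0)
  have "\<exists>!f. (\<forall>i\<in>I. f i \<in> U \<inter> W i) \<and> (\<forall>i. i \<notin> I \<longrightarrow> f i = 0) \<and>
      finite {i. f i \<noteq> 0} \<and> x = (\<Sum>i | f i \<noteq> 0. f i)" (is "\<exists>!f. ?P f") if x: "x \<in> U" for x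
  proof -
    have xV: "x \<in> V" using x U by blast
    obtain f where f: "\<forall>i\<in>I. f i \<in> W i" "\<forall>i. i \<notin> I \<longrightarrow> f i = 0" "finite {i. f i \<noteq> 0}"
      "x = (\<Sum>i | f i \<noteq> 0. f i)"
      using ex1[OF xV] by blast
    have fV: "f i \<in> V" for i using f W V subspace_0 by (cases "i \<in> I") auto
    have "x = p x" using p_id x by simp
    also have "\<dots> = (\<Sum>i | f i \<noteq> 0. p (f i))" using p_sum f(3,4) fV by blast
    \<comment> \<open>The projection may kill some components, so the index set shrinks to the
      support of the projected family.\<close>
    also have "\<dots> = (\<Sum>i | p (f i) \<noteq> 0. p (f i))"
      by (rule sum.mono_neutral_right) (use f(3) p0 in auto)
    finally have "x = (\<Sum>i | p (f i) \<noteq> 0. p (f i))" .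
    moreover have "finite {i. p (f i) \<noteq> 0}"
      by (rule finite_subset[OF _ f(3)]) (use p0 in auto)
    ultimately have "?P (\<lambda>i. p (f i))" using p_in p_W f fV p0 by auto
    then have "\<exists>f. ?P f" by (rule exI[where P = ?P])
    then show ?thesis
    proof (rule ex_ex1I)
      fix u v assume u: "?P u" and v: "?P v"
      show "u = v"
        \<comment> \<open>A decomposition inside \<open>U\<close> is also one inside
          \<open>V\<close>, where uniqueness is known.\<close>
        by (rule Uniq_D[OF conjunct2[OF ex1[OF xV, unfolded ex1_iff_ex_Uniq]]])
          (use u v in blast)+
    qed
  qed
  then show ?thesis using U W subspace_inter unfolding is_direct_sum_def by blast
qed

end

section \<open>The projection onto the even part, and the even part as a Lie superalgebra\<close>

context lie_superalgebra
begin

lemma L_subspace: "subspace L"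
  and g_subspace: "subspace (g i)"
  and g_subset_L: "g i \<subseteq> L"
  using grading by (auto simp: is_direct_sum_def)

lemma g_inter: "\<lbrakk>x \<in> g 0; x \<in> g 1\<rbrakk> \<Longrightarrow> x = 0"
  and g_decomp: "x \<in> L \<Longrightarrow> \<exists>a\<in>g 0. \<exists>b\<in>g 1. x = a + b"
  using grading by (auto simp: is_direct_sum_bit_iff)

text \<open>Meaningful only for \<open>x \<in> L\<close>: existence of \<open>a\<close> is
  \<open>g_decomp\<close>, and uniqueness follows from \<open>g_inter\<close>.\<close>

definition even_part :: "'v \<Rightarrow> 'v"
  where "even_part x = (THE a. a \<in> g 0 \<and> x - a \<in> g 1)"

text \<open>Two candidates differ by an element that is both even and odd. The later properties of
  \<open>even_part\<close> follow by exhibiting an even candidate and checking that the remainder is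
  odd.\<close>

lemma even_part_eqI:
  assumes "a \<in> g 0" "x - a \<in> g 1"
  shows "even_part x = a"
  unfolding even_part_def
proof (rule the_equality)
  fix b assume b: "b \<in> g 0 \<and> x - b \<in> g 1"
  have "b - a \<in> g 0" by (rule subspace_diff[OF g_subspace]) (use assms b in auto)
  \<comment> \<open>This difference is again \<open>b - a\<close>.\<close>
  moreover have "(x - a) - (x - b) \<in> g 1"
    by (rule subspace_diff[OF g_subspace]) (use assms b in auto)
  ultimately have "b - a = 0" using g_inter[of "b - a"] by simp
  then show "b = a" by simp
qed (use assms in blast)

lemma even_part:
  assumes "x \<in> L"
  shows "even_part x \<in> g 0" "x - even_part x \<in> g 1"
proof -
  obtain a b where "a \<in> g 0" "b \<in> g 1" "x = a + b" using g_decomp assms by blast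
  moreover from this have "even_part x = a" by (intro even_part_eqI) simp_all
  ultimately show "even_part x \<in> g 0" "x - even_part x \<in> g 1" by simp_all
qed

lemma even_part_id: "x \<in> g 0 \<Longrightarrow> even_part x = x"
  by (rule even_part_eqI) (simp_all add: subspace_0 g_subspace)

lemma even_part_add:
  assumes "x \<in> L" "y \<in> L"
  shows "even_part (x + y) = even_part x + even_part y"
proof (rule even_part_eqI)
  show "even_part x + even_part y \<in> g 0"
    by (intro subspace_add g_subspace even_part assms)
  have "(x - even_part x) + (y - even_part y) \<in> g 1"
    by (intro subspace_add g_subspace even_part assms)
  then show "x + y - (even_part x + even_part y) \<in> g 1" by (simp add: algebra_simps)
qed

lemma even_part_scale:
  assumes "x \<in> L"
  shows "even_part (c *s x) = c *s even_part x"
proof (rule even_part_eqI)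
  show "c *s even_part x \<in> g 0" by (intro subspace_scale g_subspace even_part assms)
  have "c *s (x - even_part x) \<in> g 1" by (intro subspace_scale g_subspace even_part assms)
  then show "c *s x - c *s even_part x \<in> g 1" by (simp add: scale_right_diff_distrib)
qed

text \<open>Bracketing with an even element preserves parity, so it maps the decomposition of
  \<open>x\<close> to that of \<open>br h x\<close>.\<close>

lemma even_part_bracket:
  assumes "h \<in> g 0" "x \<in> L"
  shows "even_part (br h x) = br h (even_part x)"
proof (rule even_part_eqI)
  show "br h (even_part x) \<in> g 0"
    using bracket_graded[of h 0 "even_part x" 0] assms even_part by simp
  have e: "even_part x \<in> L" "x - even_part x \<in> L" "h \<in> L"
    using assms even_part g_subset_L by blast+
  have "linear_on scale scale L (br h)"
    using bracket_bilinear e unfolding bilinear_on_def by blast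
  from linear_on_add[OF this e(1,2)]
  have "br h x - br h (even_part x) = br h (x - even_part x)" by simp
  then show "br h x - br h (even_part x) \<in> g 1"
    using bracket_graded[of h 0 "x - even_part x" 1] assms even_part by simp
qed

text \<open>A grading must be indexed by all of \<open>bit\<close>, so the purely even algebra gets
  the zero space in degree 1.\<close>

abbreviation even_grading :: "bit \<Rightarrow> 'v set"
  where "even_grading \<equiv> \<lambda>i. if i = 0 then g 0 else {0}"

lemma even_grading_subset: "x \<in> even_grading i \<Longrightarrow> x \<in> g i"
  using g_subspace subspace_0 by (cases i) auto

text \<open>Skew-symmetry and the Jacobi identity carry over with the same signs because
  \<open>even_grading i\<close> lies in \<open>g i\<close>. Gradedness of the bracket needs an
  argument, as the odd component is now \<open>{0}\<close>.\<close>

lemma even_lie_superalgebra: "lie_superalgebra scale (g 0) even_grading br"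
proof unfold_locales
  show "is_direct_sum (g 0) UNIV even_grading"
    unfolding is_direct_sum_bit_iff
    using g_subspace[of 0] subspace_0 by (auto simp: subspace_single_0)
next
  show "bilinear_on scale scale (g 0) br"
    using bracket_bilinear g_subset_L bilinear_on_mono by blast
next
  fix x y i j assume xy: "x \<in> even_grading i" "y \<in> even_grading j"
  have "br x y \<in> g (i + j)" using bracket_graded xy even_grading_subset by blast
  \<comment> \<open>A total degree of 1 forces one argument to have degree 1, hence to be
    \<open>0\<close>.\<close>
  moreover have "br x y = 0" if "i + j = 1"
  proof -
    have "i = 1 \<or> j = 1" using that by (cases i; cases j) auto
    then have "x = 0 \<or> y = 0" using xy by auto
    moreover have "x \<in> L" "y \<in> L" "0 \<in> L"
      using xy even_grading_subset g_subset_L L_subspace subspace_0 by blast+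
    ultimately show ?thesis using bilinear_on_zero[OF bracket_bilinear] by auto
  qed
  ultimately show "br x y \<in> even_grading (i + j)" by (cases "i + j") auto
next
  fix x y i j assume "x \<in> even_grading i" "y \<in> even_grading j"
  then show "br x y = - (koszul_sign i j *s br y x)"
    by (intro bracket_skew even_grading_subset)
next
  fix x y z i j k
  assume "x \<in> even_grading i" "y \<in> even_grading j" "z \<in> even_grading k"
  then show "br x (br y z) = br (br x y) z + koszul_sign i j *s br y (br x z)"
    by (intro bracket_jacobi[of x i y j z k] even_grading_subset)
qed

end

section \<open>The even part as a super-toral triple\<close>

context super_toral_triple
begin

lemma even_part_weight_space:
  assumes "x \<in> weight_space \<alpha>"
  shows "even_part x \<in> weight_space \<alpha>"
proof -
  have x: "x \<in> L" and w: "\<And>h. h \<in> H \<Longrightarrow> br h x = \<alpha> h *s x"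
    using assms unfolding weight_space_def by auto
  have "br h (even_part x) = \<alpha> h *s even_part x" if "h \<in> H" for h
    using even_part_bracket[of h x] w[OF that] x that H_even even_part_scale by auto
  then show ?thesis using even_part(1)[OF x] g_subset_L unfolding weight_space_def by blast
qed

text \<open>An even element pairs to zero with odd ones, so its pairing with \<open>z\<close> sees
  only \<open>even_part z\<close>. Hence an even element orthogonal to \<open>g 0\<close> is
  orthogonal to all of \<open>L\<close>.\<close>

lemma even_form_nondegenerate: "nondegenerate_on (g 0) form"
proof -
  have form0: "form x z = form x (even_part z) \<and> form z x = form (even_part z) x"
    if x: "x \<in> g 0" and z: "z \<in> L" for x z
  proof -
    note e = even_part[OF z]
    have L: "even_part z \<in> L" "z - even_part z \<in> L" "x \<in> L" using e x g_subset_L by blast+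
    then have "linear_on scale (*) L (form x)" "linear_on scale (*) L (\<lambda>y. form y x)"
      using form_bilinear unfolding bilinear_on_def by blast+
    from this[THEN linear_on_add, OF L(1,2)]
    show ?thesis using form_even[OF x e(2)] form_even[OF e(2) x] by simp
  qed
  show ?thesis
    using form_nondegenerate form0 even_part(1) g_subset_L
    unfolding nondegenerate_on_def by (metis subsetD)
qed

lemma even_super_toral_triple: "super_toral_triple scale (g 0) even_grading br H form"
proof -
  interpret even: lie_superalgebra scale "g 0" even_grading br
    by (rule even_lie_superalgebra)
  interpret even: lie_superalgebra_with_subalgebra scale "g 0" even_grading br H
    by unfold_locales (use H_subspace H_even H_closed in auto)
  \<comment> \<open>This puts the weight spaces of \<open>g 0\<close> into the form
    \<open>U \<inter> W i\<close> produced by \<open>is_direct_sum_projection\<close>.\<close>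
  have ws: "even.weight_space \<alpha> = g 0 \<inter> weight_space \<alpha>" for \<alpha>
    using g_subset_L unfolding even.weight_space_def weight_space_def by blast
  show ?thesis
  proof unfold_locales
    show "g 0 \<noteq> {0}" using H_nonzero H_even H_subspace subspace_0 by blast
  next
    show "H \<noteq> {0}" by (rule H_nonzero)
  next
    show "bilinear_on scale (*) (g 0) form"
      using form_bilinear g_subset_L bilinear_on_mono by blast
  next
    show "nondegenerate_on (g 0) form" by (rule even_form_nondegenerate)
  next
    fix x y z assume "x \<in> g 0" "y \<in> g 0" "z \<in> g 0"
    then show "form (br x y) z = form x (br y z)" using form_invariant g_subset_L by blast
  next
    fix x y i j assume "x \<in> even_grading i" "y \<in> even_grading j" "i \<noteq> j"
    then show "form x y = 0" using form_even even_grading_subset by blast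
  next
    fix x y i j assume "x \<in> even_grading i" "y \<in> even_grading j"
    then show "form x y = koszul_sign i j * form y x"
      by (intro form_supersymmetric even_grading_subset)
  next
    show "is_direct_sum (g 0) (dual H) even.weight_space"
      unfolding ws
      by (rule is_direct_sum_projection[OF weight_decomposition g_subspace g_subset_L,
            where p = even_part])
        (simp_all add: even_part_add even_part(1) even_part_id even_part_weight_space)
  next
    show "nondegenerate_on H form" by (rule form_nondegenerate_H)
  qed
qed

end

section \<open>Root pairing and local nilpotency on the even part\<close>

context extended_affine_lie_superalgebra
begin

lemma even_extended_affine:
  "extended_affine_lie_superalgebra scale (g 0) even_grading br H form"
proof -
  interpret even: super_toral_triple scale "g 0" even_grading br H form
    by (rule even_super_toral_triple)
  have ws: "even.weight_space \<alpha> = homogeneous_weight_space 0 \<alpha>" for \<alpha>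
    using g_subset_L
    unfolding even.weight_space_def homogeneous_weight_space_def weight_space_def by blast
  have hws: "even.homogeneous_weight_space 0 \<alpha> = homogeneous_weight_space 0 \<alpha>" for \<alpha>
    unfolding even.homogeneous_weight_space_def ws by (auto simp: homogeneous_weight_space_def)
  have roots0: "even.homogeneous_roots 0 = homogeneous_roots 0"
    unfolding even.homogeneous_roots_def homogeneous_roots_def hws ..
  \<comment> \<open>Since \<open>even_grading 1 = {0}\<close>, it remains to see that weight spaces
    contain \<open>0\<close>: an empty homogeneous weight space would differ from \<open>{0}\<close>
    and count as a root space.\<close>
  have roots1: "even.homogeneous_roots 1 = {}"
  proof -
    have "0 \<in> even.weight_space \<alpha>" if "\<alpha> \<in> dual H" for \<alpha>
      using even.weight_decomposition that subspace_0 unfolding is_direct_sum_def by blast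
    then show ?thesis
      unfolding even.homogeneous_roots_def even.homogeneous_weight_space_def by auto
  qed
  show ?thesis
  proof unfold_locales
    fix \<alpha> i assume \<alpha>: "\<alpha> \<in> even.homogeneous_roots i" "\<alpha> \<noteq> (\<lambda>_. 0)"
    then have i: "i = 0" using roots1 by (cases i) auto
    show "\<exists>x\<in>even.homogeneous_weight_space i \<alpha>.
        \<exists>y\<in>even.homogeneous_weight_space i (\<lambda>h. - \<alpha> h). br x y \<noteq> 0 \<and> br x y \<in> H"
      \<comment> \<open>The pairing axiom of \<open>L\<close> in degree 0 already supplies even
        vectors.\<close>
      using root_pairing[of \<alpha> 0] \<alpha> unfolding i hws roots0 .
  next
    fix \<alpha> x y
    assume \<alpha>: "\<alpha> \<in> even.roots" "even.dual_form \<alpha> \<alpha> \<noteq> 0"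
      and x: "x \<in> even.weight_space \<alpha>" and y: "y \<in> g 0"
    have "\<alpha> \<in> roots" using \<alpha>(1) roots_eq_Un even.roots_eq_Un roots0 roots1 by auto
    \<comment> \<open>\<open>t_elem\<close> and \<open>dual_form\<close> refer only to
      \<open>H\<close> and \<open>form\<close>, so both structures unfold to the same term.\<close>
    moreover have "dual_form \<alpha> \<alpha> \<noteq> 0"
      using \<alpha>(2)
      unfolding even.dual_form_def dual_form_def even.t_elem_def t_elem_def .
    moreover have "x \<in> weight_space \<alpha>"
      using x unfolding ws homogeneous_weight_space_def by blast
    ultimately show "\<exists>n. (br x ^^ n) y = 0"
      using ad_locally_nilpotent y g_subset_L by blast
  qed
qed

end

theorem proposition3p3:
  fixes scale :: "'k::field_char_0 \<Rightarrow> 'v::ab_group_add \<Rightarrow> 'v"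
    and L :: "'v set" and g :: "bit \<Rightarrow> 'v set" and br :: "'v \<Rightarrow> 'v \<Rightarrow> 'v"
    and H :: "'v set" and form :: "'v \<Rightarrow> 'v \<Rightarrow> 'k"
  assumes "extended_affine_lie_superalgebra scale L g br H form"
  shows "invariant_affine_reflection_algebra scale
    (g 0) (\<lambda>i. if i = 0 then g 0 else {0}) br H form"
proof -
  interpret extended_affine_lie_superalgebra scale L g br H form by (rule assms)
  interpret even: extended_affine_lie_superalgebra scale "g 0" even_grading br H form
    by (rule even_extended_affine)
  \<comment> \<open>The remaining obligation is that the odd component is \<open>{0}\<close>, which
    is the value of the grading at 1.\<close>
  show ?thesis by unfold_locales simp
qed

end
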